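(* Let $(D_n)$ and $(M_n)$ be two sequences of positive real numbers such that $D_n\leq M_n$ for all $n$. Then there exists a sequence of irreducible $n\times n$ max-plus matrices $A_n$ such that $\lambda(A_n)-\lambda_2(A_n)=D_n$, $\lVert A_n\rVert=M_n$, and the transient of the sequence of max-plus powers $A_n^{\otimes k}$ is \[ \Omega\!\left(\frac{n^2\lVert A_n\rVert}{\lambda(A_n)-\lambda_2(A_n)}\right)\quad (n\to\infty). \]
   Context: Max-plus algebra: $\mathbb{R}_{\max}=\mathbb{R}\cup\{-\infty\}$ with $a\oplus b=\max\{a,b\}$ and $a\otimes b=a+b$. A max-plus matrix has entries in $\mathbb{R}_{\max}$; the product is $(A\otimes B)_{i,j}=\max_h (A_{i,h}+B_{h,j})$ and $A^{\otimes k}$ is the $k$-th max-plus power. The digraph $G(A)$ has node set $\{1,\dots,n\}$ and an edge $(i,j)$ iff $A_{i,j}\neq-\infty$, with weight $A_{i,j}$; $A$ is irreducible if $G(A)$ is strongly connected. The weight $A(\Gamma)$ of a cycle $\Gamma$ is the sum of its edge weights and $\ell(\Gamma)$ its length. $\lambda(A)$ is the maximum of $A(\Gamma)/\ell(\Gamma)$ over cycles of $G(A)$; $\lambda_2(A)$ is the second largest cycle mean, i.e. the maximum of $A(\Gamma)/\ell(\Gamma)$ over cycles with $A(\Gamma)/\ell(\Gamma)<\lambda(A)$. $\lVert A\rVert$ is the difference between the greatest and the smallest finite entries of $A$. A matrix sequence $a(k)$ is eventually periodic with period $p\geq1$ and ratio $\varrho\in\mathbb{R}$ if there is $K$ with $a(k+p)=a(k)+p\varrho$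 entrywise for all $k\geq K$; the transient is the smallest such $K$. For irreducible $A$ the sequence $A^{\otimes k}$ is eventually periodic with ratio $\lambda(A)$.
   Formalization: The equalities for the gap and for the norm are claimed only for n ≥ 2: a 1×1 matrix has at most one finite entry, so its norm is 0 rather than the positive M_1, and it has no second largest cycle mean. *)

theory Defs
  imports
    "Jordan_Normal_Form.Matrix"
    "Graph_Theory.Graph_Theory"
    "HOL-Library.Landau_Symbols"
begin

section \<open>The max-plus semiring\<close>

text \<open>
  In the semiring structure below \<open>+\<close> is the maximum, \<open>*\<close> is real addition,
  \<open>0\<close> is minus infinity and \<open>1\<close> is the real number zero.  Hence matrix
  multiplication and \<open>A ^\<^sub>m k\<close> on matrices over this type are the max-plus
  product and the max-plus power.
\<close>

datatype maxplus = NegInf | Fin (the_fin: real)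

instantiation maxplus :: linorder
begin

fun less_eq_maxplus :: "maxplus \<Rightarrow> maxplus \<Rightarrow> bool" where
  "NegInf \<le> y \<longleftrightarrow> True"
| "Fin a \<le> NegInf \<longleftrightarrow> False"
| "Fin a \<le> Fin b \<longleftrightarrow> a \<le> b"

definition less_maxplus :: "maxplus \<Rightarrow> maxplus \<Rightarrow> bool" where
  "x < y \<longleftrightarrow> x \<le> y \<and> \<not> y \<le> (x :: maxplus)"

instance
proof
  fix x y z :: maxplus
  show "x < y \<longleftrightarrow> x \<le> y \<and> \<not> y \<le> x" by (simp add: less_maxplus_def)
  show "x \<le> x" by (cases x) auto
  show "x \<le> z" if "x \<le> y" "y \<le> z" using that by (cases x; cases y; cases z) auto
  show "x = y" if "x \<le> y" "y \<le> x" using that by (cases x; cases y) auto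
  show "x \<le> y \<or> y \<le> x" by (cases x; cases y) auto
qed

end

instantiation maxplus :: comm_semiring_1
begin

definition plus_maxplus :: "maxplus \<Rightarrow> maxplus \<Rightarrow> maxplus" where
  "x + y = max x (y :: maxplus)"

fun times_maxplus :: "maxplus \<Rightarrow> maxplus \<Rightarrow> maxplus" where
  "NegInf * y = NegInf"
| "Fin a * NegInf = NegInf"
| "Fin a * Fin b = Fin (a + b)"

definition zero_maxplus :: maxplus where "0 = NegInf"
definition one_maxplus :: maxplus where "1 = Fin 0"

instance
proof
  fix x y z :: maxplus
  show "x + y + z = x + (y + z)" by (simp add: plus_maxplus_def max.assoc)
  show "x + y = y + x" by (simp add: plus_maxplus_def max.commute)
  show "0 + x = x" by (simp add: plus_maxplus_def zero_maxplus_def max_def)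
  show "x * y * z = x * (y * z)" by (cases x; cases y; cases z) auto
  show "x * y = y * x" by (cases x; cases y) auto
  show "1 * x = x" by (cases x) (auto simp: one_maxplus_def)
  show "(x + y) * z = x * z + y * z"
    by (cases x; cases y; cases z) (auto simp: plus_maxplus_def max_def)
  show "0 * x = 0" "x * 0 = 0" by (cases x; auto simp: zero_maxplus_def)+
  show "(0::maxplus) \<noteq> 1" by (simp add: zero_maxplus_def one_maxplus_def)
qed

end

lemma sum_maxplus_eq_Max:
  fixes f :: "'a \<Rightarrow> maxplus"
  assumes "finite S" "S \<noteq> {}"
  shows "sum f S = Max (f ` S)"
  using assms
proof (induction S rule: finite_ne_induct)
  case (singleton x)
  show ?case using add_0_right[of "f x"] by simp
next
  case (insert x F)
  then show ?case by (simp add: plus_maxplus_def)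
qed

lemma maxplus_mult_mat_entry:
  fixes A B :: "maxplus mat"
  assumes "A \<in> carrier_mat n n" "B \<in> carrier_mat n n" "i < n" "j < n"
  shows "(A * B) $$ (i, j) = Max ((\<lambda>h. A $$ (i, h) * B $$ (h, j)) ` {0..<n})"
proof -
  have "(A * B) $$ (i, j) = (\<Sum>h = 0..<n. A $$ (i, h) * B $$ (h, j))"
    using assms by (simp add: scalar_prod_def)
  then show ?thesis
    using assms by (simp add: sum_maxplus_eq_Max)
qed


section \<open>The digraph of a matrix and its cycle means\<close>

text \<open>Nodes are numbered from \<open>0\<close> to \<open>n - 1\<close>, as are the matrix indices.\<close>

definition mat_digraph :: "maxplus mat \<Rightarrow> (nat, nat \<times> nat) pre_digraph" where
  "mat_digraph A =
     \<lparr>verts = {0..<dim_row A},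
      arcs = {(i, j). i < dim_row A \<and> j < dim_col A \<and> A $$ (i, j) \<noteq> NegInf},
      tail = fst, head = snd\<rparr>"

definition irreducible_mat :: "maxplus mat \<Rightarrow> bool" where
  "irreducible_mat A \<longleftrightarrow> strongly_connected (mat_digraph A)"

definition walk_weight :: "maxplus mat \<Rightarrow> (nat \<times> nat) list \<Rightarrow> real" where
  "walk_weight A p = (\<Sum>e\<leftarrow>p. the_fin (A $$ e))"

text \<open>
  \<open>pre_digraph.cycle\<close> describes elementary cycles (no repeated node), loops
  included, so there are only finitely many of them.  With arbitrary closed
  walks the maximum defining the second largest cycle mean would in general
  not exist.
\<close>

definition cycle_means :: "maxplus mat \<Rightarrow> real set" where
  "cycle_means A =
     {walk_weight A p / real (length p) |p. pre_digraph.cycle (mat_digraph A) p}"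

definition max_cycle_mean :: "maxplus mat \<Rightarrow> real" where
  "max_cycle_mean A = Max (cycle_means A)"

definition noncritical_cycle_means :: "maxplus mat \<Rightarrow> real set" where
  "noncritical_cycle_means A = {m \<in> cycle_means A. m < max_cycle_mean A}"

text \<open>Meaningful only if \<open>noncritical_cycle_means A\<close> is nonempty.\<close>

definition second_cycle_mean :: "maxplus mat \<Rightarrow> real" where
  "second_cycle_mean A = Max (noncritical_cycle_means A)"

definition finite_entries :: "maxplus mat \<Rightarrow> real set" where
  "finite_entries A = {w. Fin w \<in> elements_mat A}"

definition mat_spread :: "maxplus mat \<Rightarrow> real" where
  "mat_spread A = Max (finite_entries A) - Min (finite_entries A)"


section \<open>Eventually periodic matrix sequences\<close>

text \<open>Scaling by \<open>Fin c\<close> adds the real number \<open>c\<close> to every entry.\<close>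

definition periodic_from :: "(nat \<Rightarrow> maxplus mat) \<Rightarrow> nat \<Rightarrow> real \<Rightarrow> nat \<Rightarrow> bool" where
  "periodic_from a p \<rho> K \<longleftrightarrow> (\<forall>k\<ge>K. a (k + p) = Fin (real p * \<rho>) \<cdot>\<^sub>m a k)"

definition transient :: "(nat \<Rightarrow> maxplus mat) \<Rightarrow> nat" where
  "transient a = (LEAST K. \<exists>p \<rho>. p \<ge> 1 \<and> periodic_from a p \<rho> K)"

lemma Fin_smult_smult_mat: "Fin b \<cdot>\<^sub>m (Fin c \<cdot>\<^sub>m A) = Fin (b + c) \<cdot>\<^sub>m A"
  by (rule eq_matI) (simp_all flip: mult.assoc)

lemma Fin_smult_mat_cancel:
  assumes "Fin c \<cdot>\<^sub>m A = Fin c \<cdot>\<^sub>m B"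
  shows "A = B"
proof -
  have one: "Fin 0 \<cdot>\<^sub>m X = X" for X :: "maxplus mat"
    by (rule eq_matI) (simp_all flip: one_maxplus_def)
  have "Fin (- c) \<cdot>\<^sub>m (Fin c \<cdot>\<^sub>m A) = Fin (- c) \<cdot>\<^sub>m (Fin c \<cdot>\<^sub>m B)"
    using assms by simp
  then show ?thesis by (simp add: Fin_smult_smult_mat one)
qed

lemma periodic_from_multiple:
  assumes "periodic_from a p \<rho> K" "k \<ge> K"
  shows "a (k + m * p) = Fin (real (m * p) * \<rho>) \<cdot>\<^sub>m a k"
proof (induction m)
  case 0
  show ?case by (rule eq_matI) (simp_all flip: one_maxplus_def)
next
  case (Suc m)
  have "a (k + Suc m * p) = a ((k + m * p) + p)" by (simp add: algebra_simps)
  also have "\<dots> = Fin (real p * \<rho>) \<cdot>\<^sub>m a (k + m * p)"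
    using assms by (simp add: periodic_from_def)
  finally show ?case
    by (simp add: Suc.IH Fin_smult_smult_mat algebra_simps)
qed

text \<open>
  The smallest \<open>K\<close> is the same for every period and ratio of the sequence, so
  quantifying over both in \<open>transient\<close> is harmless.
\<close>

lemma periodic_from_threshold_unique:
  assumes K: "periodic_from a p \<rho> K" and p: "p \<ge> 1"
    and K': "periodic_from a p' \<rho>' K'"
  shows "periodic_from a p' \<rho>' K"
  unfolding periodic_from_def
proof (intro allI impI)
  fix k assume k: "K \<le> k"
  let ?s = "real (K' * p) * \<rho>"
  have ge: "K' \<le> k + K' * p" using p by (cases p) auto
  have "Fin ?s \<cdot>\<^sub>m a (k + p') = a (k + p' + K' * p)"
    using periodic_from_multiple[OF K, of "k + p'" K'] k by simp
  also have "\<dots> = a ((k + K' * p) + p')" by (simp add: algebra_simps)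
  also have "\<dots> = Fin (real p' * \<rho>') \<cdot>\<^sub>m a (k + K' * p)"
    using K' ge by (simp add: periodic_from_def)
  also have "\<dots> = Fin (real p' * \<rho>') \<cdot>\<^sub>m (Fin ?s \<cdot>\<^sub>m a k)"
    using periodic_from_multiple[OF K k, of K'] by simp
  also have "\<dots> = Fin ?s \<cdot>\<^sub>m (Fin (real p' * \<rho>') \<cdot>\<^sub>m a k)"
    by (simp add: Fin_smult_smult_mat add.commute)
  finally show "a (k + p') = Fin (real p' * \<rho>') \<cdot>\<^sub>m a k"
    by (rule Fin_smult_mat_cancel)
qed

end

theory Submission
  imports Defs
begin

text \<open>
  Take a critical cycle of length \<open>l\<close> and weight \<open>0\<close>, a slow cycle of the same length \<open>l\<close> with
  mean \<open>- D\<close>, and join one node of each by a closed path of length \<open>m = n - 2 l + 2\<close> all of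
  whose edges have weight \<open>- M\<close>.  Since both cycles have length \<open>l\<close>, a closed walk at the slow
  node whose length \<open>k\<close> is divisible by \<open>l\<close> either stays on the slow cycle, with weight \<open>- D k\<close>, or
  makes \<open>t \<ge> 1\<close> round trips with \<open>l\<close> dividing \<open>t m\<close>.  Choosing \<open>l\<close> near \<open>n / 3\<close> such that \<open>m\<close> is
  \<open>1\<close>, \<open>2\<close> or \<open>3\<close> modulo \<open>l\<close> forces \<open>t \<ge> l / 3\<close>, at a cost of at least \<open>M l m / 3\<close>, which is of order
  \<open>n\<^sup>2 M\<close>.  Hence the slow cycle stays optimal up to a length of order \<open>n\<^sup>2 M / D\<close>, and as long as it
  does the powers are not periodic with ratio \<open>0\<close>.
\<close>

section \<open>Powers of max-plus matrices\<close>

lemma mult_neq_NegInf: "x * y \<noteq> NegInf \<longleftrightarrow> x \<noteq> NegInf \<and> y \<noteq> NegInf"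
  by (cases x; cases y) auto

lemma maxplus_mult_mono: "x \<le> x' \<Longrightarrow> y \<le> y' \<Longrightarrow> x * y \<le> x' * (y' :: maxplus)"
  by (cases x; cases x'; cases y; cases y') auto

lemma NegInf_le [simp]: "NegInf \<le> x" and le_NegInf_iff [simp]: "x \<le> NegInf \<longleftrightarrow> x = NegInf"
  by (cases x; simp)+

context
  fixes A :: "maxplus mat" and n :: nat
  assumes A: "A \<in> carrier_mat n n"
begin

lemma pow_mat_add: "A ^\<^sub>m (k + l) = A ^\<^sub>m k * A ^\<^sub>m l"
proof (induction l)
  case 0
  show ?case using A by (simp add: pow_carrier_mat)
next
  case (Suc l)
  then show ?case
    using A by (simp add: assoc_mult_mat[of _ n n _ n _ n])
qed

lemma pow_entry_supermult:
  assumes "i < n" "h < n" "j < n"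
  shows "(A ^\<^sub>m k) $$ (i, h) * (A ^\<^sub>m l) $$ (h, j) \<le> (A ^\<^sub>m (k + l)) $$ (i, j)"
  using A assms
  by (subst pow_mat_add, subst maxplus_mult_mat_entry[of _ n]) (auto intro!: Max_ge)

text \<open>Peels the last edge off an optimal walk; the later inductions on the length of a walk
  rest on this.\<close>

lemma pow_entry_Suc_attained:
  assumes "i < n" "j < n"
  obtains h where "h < n" "(A ^\<^sub>m Suc k) $$ (i, j) = (A ^\<^sub>m k) $$ (i, h) * A $$ (h, j)"
proof -
  have "(A ^\<^sub>m Suc k) $$ (i, j) = Max ((\<lambda>h. (A ^\<^sub>m k) $$ (i, h) * A $$ (h, j)) ` {0..<n})"
    unfolding pow_mat.simps
    using pow_carrier_mat[OF A] A assms by (rule maxplus_mult_mat_entry)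
  also have "\<dots> \<in> (\<lambda>h. (A ^\<^sub>m k) $$ (i, h) * A $$ (h, j)) ` {0..<n}"
    using assms by (intro Max_in) auto
  finally show ?thesis using that by auto
qed

text \<open>The maximum defining an entry is attained, so the entry is a single product and closure
  under \<open>*\<close> carries the induction.\<close>

lemma pow_entry_in_subsemiring:
  assumes S: "0 \<in> S" "1 \<in> S" "\<And>x y. x \<in> S \<Longrightarrow> y \<in> S \<Longrightarrow> x * y \<in> S"
    and entries: "\<And>i j. i < n \<Longrightarrow> j < n \<Longrightarrow> A $$ (i, j) \<in> S"
    and ij: "i < n" "j < n"
  shows "(A ^\<^sub>m k) $$ (i, j) \<in> S"
  using ij
proof (induction k arbitrary: j)
  case 0
  then show ?case using S A by auto
next
  case (Suc k)
  obtain h where "h < n" "(A ^\<^sub>m Suc k) $$ (i, j) = (A ^\<^sub>m k) $$ (i, h) * A $$ (h, j)"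
    using pow_entry_Suc_attained Suc.prems .
  then show ?case using Suc S entries by auto
qed

section \<open>Lower bounds on the finite entries and eventual periodicity\<close>

lemma irreducible_pow_entry:
  assumes "irreducible_mat A" and ij: "i < n" "j < n"
  obtains k where "(A ^\<^sub>m k) $$ (i, j) \<noteq> NegInf"
proof -
  have "i \<rightarrow>\<^sup>*\<^bsub>mat_digraph A\<^esub> j"
    using assms A by (auto simp: irreducible_mat_def strongly_connected_def mat_digraph_def)
  then have "\<exists>k. (A ^\<^sub>m k) $$ (i, j) \<noteq> NegInf"
    unfolding reachable_def
  proof (induction rule: rtrancl_on_induct)
    case base
    have "(A ^\<^sub>m 0) $$ (i, i) \<noteq> NegInf" using A ij by (auto simp: one_maxplus_def)
    then show ?case by blast
  next
    case (step y z)
    then obtain k where k: "(A ^\<^sub>m k) $$ (i, y) \<noteq> NegInf" by auto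
    have yz: "y < n" "z < n" "A $$ (y, z) \<noteq> NegInf"
      using step(2) A by (auto simp: arcs_ends_def arc_to_ends_def mat_digraph_def)
    have "(A ^\<^sub>m k) $$ (i, y) * (A ^\<^sub>m 1) $$ (y, z) \<le> (A ^\<^sub>m (k + 1)) $$ (i, z)"
      using pow_entry_supermult ij yz by blast
    moreover have "A ^\<^sub>m 1 = A" using A by simp
    ultimately have "(A ^\<^sub>m (k + 1)) $$ (i, z) \<noteq> NegInf"
      using k yz mult_neq_NegInf by (metis le_NegInf_iff)
    then show ?case by blast
  qed
  then show ?thesis using that by blast
qed

lemma pow_diag_power_le:
  assumes "i < n"
  shows "(A ^\<^sub>m k) $$ (i, i) ^ t \<le> (A ^\<^sub>m (t * k)) $$ (i, i)"
proof (induction t)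
  case 0
  then show ?case using A assms by auto
next
  case (Suc t)
  have "(A ^\<^sub>m k) $$ (i, i) ^ Suc t \<le> (A ^\<^sub>m k) $$ (i, i) * (A ^\<^sub>m (t * k)) $$ (i, i)"
    using Suc by (auto intro!: maxplus_mult_mono)
  also have "\<dots> \<le> (A ^\<^sub>m (k + t * k)) $$ (i, i)"
    by (rule pow_entry_supermult) (use assms in auto)
  finally show ?case by simp
qed

text \<open>
  Prepending \<open>l\<close> copies of a closed walk from \<open>i\<close> through \<open>c\<close> to a walk from \<open>i\<close> to \<open>j\<close> keeps the
  length modulo \<open>l\<close>; the free returns at \<open>c\<close> then reach every larger length of that class.
\<close>

lemma pow_entry_bounded_below_class:
  assumes irr: "irreducible_mat A" and c: "c < n" and crit: "1 \<le> (A ^\<^sub>m l) $$ (c, c)"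
    and l: "l \<ge> 1" and ij: "i < n" "j < n"
  shows "\<exists>B. \<forall>k. k mod l = r \<longrightarrow> (A ^\<^sub>m k) $$ (i, j) \<noteq> NegInf \<longrightarrow> Fin B \<le> (A ^\<^sub>m k) $$ (i, j)"
proof (cases "\<exists>k. k mod l = r \<and> (A ^\<^sub>m k) $$ (i, j) \<noteq> NegInf")
  case True
  let ?a = "\<lambda>k i j. (A ^\<^sub>m k) $$ (i, j)"
  obtain k0 where k0: "k0 mod l = r" "?a k0 i j \<noteq> NegInf" using True by blast
  obtain q1 where q1: "?a q1 i c \<noteq> NegInf" using irreducible_pow_entry irr ij c by metis
  obtain q2 where q2: "?a q2 c i \<noteq> NegInf" using irreducible_pow_entry irr ij c by metis
  define s where "s = q1 + q2"
  have pow1: "1 \<le> x ^ t" if "1 \<le> x" for x :: maxplus and t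
  proof (induction t)
    case (Suc t)
    then show ?case using maxplus_mult_mono[OF that Suc] by simp
  qed simp
  have pow_fin: "x ^ t \<noteq> NegInf" if "x \<noteq> NegInf" for x :: maxplus and t
    using that by (induction t) (auto simp: mult_neq_NegInf one_maxplus_def)
  define w where "w = ?a q1 i c * ?a q2 c i"
  have w: "w \<noteq> NegInf" using q1 q2 by (simp add: w_def mult_neq_NegInf)
  have through: "w \<le> ?a (s + t * l) i i" for t
  proof -
    have "?a q1 i c * 1 \<le> ?a q1 i c * ?a (t * l) c c"
      using pow1[OF crit] pow_diag_power_le[OF c]
      by (intro maxplus_mult_mono order.refl) (rule order.trans)
    also have "\<dots> \<le> ?a (q1 + t * l) i c"
      by (rule pow_entry_supermult) (use ij c in auto)
    finally have "w \<le> ?a (q1 + t * l) i c * ?a q2 c i"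
      unfolding w_def by (intro maxplus_mult_mono) auto
    also have "\<dots> \<le> ?a (q1 + t * l + q2) i i"
      by (rule pow_entry_supermult) (use ij c in auto)
    finally show ?thesis by (simp add: s_def algebra_simps)
  qed
  have "?a s i i \<noteq> NegInf" using through[of 0] w by auto
  then have "?a s i i ^ (l - 1) \<noteq> NegInf" by (rule pow_fin)
  then have turns: "?a ((l - 1) * s) i i \<noteq> NegInf"
    using pow_diag_power_le[of i s "l - 1"] ij by auto
  \<comment> \<open>One of the \<open>l\<close> closed walks of length \<open>s\<close> takes
    \<open>t\<close> extra returns at \<open>c\<close>, the other \<open>l - 1\<close> are plain.
    The total length \<open>k0 + s * l + t * l\<close> stays in the class of
    \<open>k0\<close>.\<close>
  define z where "z = w * (?a ((l - 1) * s) i i * ?a k0 i j)"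
  have "z \<noteq> NegInf" using w turns k0 by (simp add: z_def mult_neq_NegInf)
  then obtain B0 where B0: "z = Fin B0" by (cases z) auto
  define N where "N = k0 + s * l"
  have late: "Fin B0 \<le> ?a (N + t * l) i j" for t
  proof -
    have "z \<le> ?a (s + t * l) i i * ?a ((l - 1) * s + k0) i j"
      unfolding z_def
      by (intro maxplus_mult_mono through pow_entry_supermult) (use ij in auto)
    also have "\<dots> \<le> ?a (s + t * l + ((l - 1) * s + k0)) i j"
      by (rule pow_entry_supermult) (use ij in auto)
    also have "s + t * l + ((l - 1) * s + k0) = N + t * l"
      using l by (cases l) (auto simp: N_def)
    finally show ?thesis using B0 by simp
  qed
  \<comment> \<open>\<open>the_fin\<close> of an infinite entry is an unspecified real, which can
    only lower the minimum.\<close>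
  define B where "B = Min (insert B0 ((\<lambda>k. the_fin (?a k i j)) ` {..<N}))"
  have "Fin B \<le> ?a k i j" if k: "k mod l = r" "?a k i j \<noteq> NegInf" for k
  proof (cases "k < N")
    case True
    then have "B \<le> the_fin (?a k i j)" unfolding B_def by (intro Min_le) auto
    then show ?thesis using k by (cases "?a k i j") auto
  next
    case False
    have "N mod l = k mod l" using k k0 by (simp add: N_def)
    then have "l dvd k - N" using False by (metis mod_eq_dvd_iff_nat linorder_not_less)
    then obtain t where t: "k - N = t * l" by (metis dvd_def mult.commute)
    have "Fin B \<le> Fin B0" unfolding B_def less_eq_maxplus.simps by (intro Min_le) auto
    also have "\<dots> \<le> ?a (N + t * l) i j" by (rule late)
    also have "N + t * l = k" using False t by simp
    finally show ?thesis .
  qed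
  then show ?thesis by blast
qed blast

text \<open>There are finitely many triples \<open>(i, j, r)\<close>, so the bounds for the residue
  classes have a common minimum.\<close>

lemma pow_entry_bounded_below:
  assumes "irreducible_mat A" "c < n" "1 \<le> (A ^\<^sub>m l) $$ (c, c)" "l \<ge> 1"
  obtains B where "\<And>i j k. i < n \<Longrightarrow> j < n \<Longrightarrow> (A ^\<^sub>m k) $$ (i, j) \<noteq> NegInf
    \<Longrightarrow> Fin B \<le> (A ^\<^sub>m k) $$ (i, j)"
proof -
  define P where "P = (\<lambda>(i, j, r) B. \<forall>k. k mod l = r \<longrightarrow> (A ^\<^sub>m k) $$ (i, j) \<noteq> NegInf
    \<longrightarrow> Fin B \<le> (A ^\<^sub>m k) $$ (i, j))"
  have "\<forall>x \<in> {..<n} \<times> {..<n} \<times> {..<l}. \<exists>B. P x B"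
    using pow_entry_bounded_below_class[OF assms] by (auto simp: P_def)
  then obtain f where f: "\<And>x. x \<in> {..<n} \<times> {..<n} \<times> {..<l} \<Longrightarrow> P x (f x)"
    by metis
  define B where "B = Min (f ` ({..<n} \<times> {..<n} \<times> {..<l}))"
  show thesis
  proof (rule that[of B])
    fix i j k assume *: "i < n" "j < n" "(A ^\<^sub>m k) $$ (i, j) \<noteq> NegInf"
    have "k mod l < l" using assms by simp
    then have "Fin B \<le> Fin (f (i, j, k mod l))"
      unfolding B_def less_eq_maxplus.simps using * by (intro Min_le) auto
    also have "\<dots> \<le> (A ^\<^sub>m k) $$ (i, j)"
      using f[of "(i, j, k mod l)"] * \<open>k mod l < l\<close> by (auto simp: P_def)
    finally show "Fin B \<le> (A ^\<^sub>m k) $$ (i, j)" .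
  qed
qed

text \<open>
  All entries lie in the finite part of \<open>S\<close> above a common bound, so two of the powers coincide.
\<close>

lemma powers_eventually_periodic:
  assumes irr: "irreducible_mat A" "c < n" "1 \<le> (A ^\<^sub>m l) $$ (c, c)" "l \<ge> 1"
    and S: "0 \<in> S" "1 \<in> S" "\<And>x y. x \<in> S \<Longrightarrow> y \<in> S \<Longrightarrow> x * y \<in> S"
      "\<And>i j. i < n \<Longrightarrow> j < n \<Longrightarrow> A $$ (i, j) \<in> S"
    and discrete: "\<And>b. finite {w \<in> S. Fin b \<le> w}"
  obtains p K where "p \<ge> 1" "periodic_from (\<lambda>k. A ^\<^sub>m k) p 0 K"
proof -
  obtain B where B: "\<And>i j k. i < n \<Longrightarrow> j < n \<Longrightarrow> (A ^\<^sub>m k) $$ (i, j) \<noteq> NegInf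
    \<Longrightarrow> Fin B \<le> (A ^\<^sub>m k) $$ (i, j)"
    using pow_entry_bounded_below[OF irr] by blast
  define V where "V = insert NegInf {w \<in> S. Fin B \<le> w}"
  define F where "F = mat n n ` (({..<n} \<times> {..<n}) \<rightarrow>\<^sub>E V)"
  have "finite F" unfolding F_def V_def using discrete by (intro finite_imageI finite_PiE) auto
  moreover have "range (\<lambda>k. A ^\<^sub>m k) \<subseteq> F"
  proof (rule image_subsetI)
    fix k
    define f where "f = restrict (\<lambda>x. (A ^\<^sub>m k) $$ x) ({..<n} \<times> {..<n})"
    have "f \<in> ({..<n} \<times> {..<n}) \<rightarrow>\<^sub>E V"
      unfolding f_def V_def using B pow_entry_in_subsemiring[OF S] by auto
    moreover have "A ^\<^sub>m k = mat n n f"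
      using A by (intro eq_matI) (auto simp: f_def)
    ultimately show "A ^\<^sub>m k \<in> F" unfolding F_def by blast
  qed
  ultimately have "finite (range (\<lambda>k. A ^\<^sub>m k))" by (rule rev_finite_subset)
  then have "\<not> inj (\<lambda>k. A ^\<^sub>m k)" using finite_imageD infinite_UNIV_nat by blast
  then obtain a b where ab: "a < b" "A ^\<^sub>m a = A ^\<^sub>m b"
    unfolding inj_def by (metis linorder_neqE_nat)
  \<comment> \<open>Multiplying the coincidence of the powers \<open>a\<close> and \<open>b\<close>
    by the power \<open>k - a\<close> gives period \<open>b - a\<close>; exact repetition means
    ratio \<open>0\<close>.\<close>
  have "A ^\<^sub>m (k + (b - a)) = Fin (real (b - a) * 0) \<cdot>\<^sub>m A ^\<^sub>m k" if "k \<ge> a" for k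
  proof -
    have "k + (b - a) = b + (k - a)" using that ab by simp
    then have "A ^\<^sub>m (k + (b - a)) = A ^\<^sub>m b * A ^\<^sub>m (k - a)"
      by (simp only: pow_mat_add)
    also have "\<dots> = A ^\<^sub>m k"
      using that ab by (simp flip: ab(2) pow_mat_add)
    finally show ?thesis by (intro eq_matI) (auto simp flip: one_maxplus_def)
  qed
  then have "periodic_from (\<lambda>k. A ^\<^sub>m k) (b - a) 0 a" by (auto simp: periodic_from_def)
  then show thesis using that[of "b - a" a] ab by auto
qed

end


section \<open>Cycles\<close>

lemma mat_digraph_simps [simp]:
  "verts (mat_digraph A) = {0..<dim_row A}"
  "tail (mat_digraph A) = fst" "head (mat_digraph A) = snd"
  "(i, j) \<in> arcs (mat_digraph A) \<longleftrightarrow> i < dim_row A \<and> j < dim_col A \<and> A $$ (i, j) \<noteq> NegInf"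
  by (auto simp: mat_digraph_def)

lemma finite_arcs_mat_digraph: "finite (arcs (mat_digraph A))"
  by (rule finite_subset[of _ "{..<dim_row A} \<times> {..<dim_col A}"]) (auto simp: mat_digraph_def)

lemma wf_mat_digraph: "A \<in> carrier_mat n n \<Longrightarrow> wf_digraph (mat_digraph A)"
  by unfold_locales (auto simp: mat_digraph_def)

text \<open>Without its start, the node list of a walk is the list of heads of its arcs. In this
  form, elementary cycles can be treated by induction on arc lists.\<close>

lemma cycle_mat_digraph_iff:
  "pre_digraph.cycle (mat_digraph A) p \<longleftrightarrow>
    (\<exists>u. u < dim_row A \<and> set p \<subseteq> arcs (mat_digraph A) \<and> pre_digraph.cas (mat_digraph A) u p u \<and>
      distinct (map snd p) \<and> p \<noteq> [])"
proof -
  have "tl (pre_digraph.awalk_verts (mat_digraph A) u p) = map snd p"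
    if "pre_digraph.cas (mat_digraph A) u p v" for u v
    using that
  proof (induction p arbitrary: u)
    case (Cons e p)
    have "pre_digraph.awalk_verts (mat_digraph A) (snd e) p
      = snd e # tl (pre_digraph.awalk_verts (mat_digraph A) (snd e) p)"
      using Cons.prems by (cases p) (auto simp: pre_digraph.awalk_verts.simps pre_digraph.cas.simps)
    then show ?case
      using Cons by (simp add: pre_digraph.awalk_verts.simps pre_digraph.cas.simps)
  qed (simp add: pre_digraph.awalk_verts.simps)
  then show ?thesis
    unfolding pre_digraph.cycle_def pre_digraph.awalk_def by auto
qed

text \<open>Both sides are the set of visited nodes; inserting the endpoints also covers the empty
  walk.\<close>

lemma cas_tails_heads:
  assumes "pre_digraph.cas (mat_digraph A) u p v"
  shows "insert v (fst ` set p) = insert u (snd ` set p)"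
  using assms
proof (induction p arbitrary: u)
  case (Cons e p)
  then show ?case using Cons.IH[of "snd e"] by (auto simp: pre_digraph.cas.simps)
qed (auto simp: pre_digraph.cas.simps)

lemma closed_cas_tails_eq_heads:
  assumes "pre_digraph.cas (mat_digraph A) u p u" "p \<noteq> []"
  shows "fst ` set p = snd ` set p"
proof -
  obtain e q where p: "p = e # q" using assms by (cases p) auto
  then have "fst e = u" "pre_digraph.cas (mat_digraph A) (snd e) q u"
    using assms by (auto simp: pre_digraph.cas.simps)
  with cas_tails_heads[OF this(2)] show ?thesis by (simp add: p)
qed

text \<open>Distinct heads force distinct arcs, so an elementary cycle is no longer than the number
  of arcs.\<close>

lemma finite_cycle_means: "finite (cycle_means A)"
proof -
  let ?E = "arcs (mat_digraph A)"
  have "length p \<le> card ?E \<and> set p \<subseteq> ?E" if "pre_digraph.cycle (mat_digraph A) p" for p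
    using that unfolding cycle_mat_digraph_iff
    by (metis card_mono distinct_card distinct_map finite_arcs_mat_digraph)
  then have "{p. pre_digraph.cycle (mat_digraph A) p} \<subseteq> {p. set p \<subseteq> ?E \<and> length p \<le> card ?E}"
    by blast
  then have "finite {p. pre_digraph.cycle (mat_digraph A) p}"
    using finite_lists_length_le[OF finite_arcs_mat_digraph] finite_subset by blast
  then show ?thesis unfolding cycle_means_def by (simp add: setcompr_eq_image)
qed

lemma walk_weight_const:
  assumes "\<And>e. e \<in> set p \<Longrightarrow> A $$ e = Fin w"
  shows "walk_weight A p = real (length p) * w"
proof -
  have "map (\<lambda>e. the_fin (A $$ e)) p = map (\<lambda>e. w) p" using assms by simp
  then show ?thesis by (simp only: walk_weight_def sum_list_triv)
qed

lemma walk_weight_le: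
  assumes "\<And>e. e \<in> set p \<Longrightarrow> the_fin (A $$ e) \<le> w"
  shows "walk_weight A p \<le> real (length p) * w"
proof -
  have "walk_weight A p \<le> (\<Sum>e\<leftarrow>p. w)"
    unfolding walk_weight_def using assms by (rule sum_list_mono)
  then show ?thesis by (simp add: sum_list_triv)
qed

lemma interval_cycle_mean:
  assumes A: "A \<in> carrier_mat n n" and b: "l \<ge> 1" "b + l \<le> n"
    and step: "\<And>i. b \<le> i \<Longrightarrow> Suc i < b + l \<Longrightarrow> A $$ (i, Suc i) = Fin w"
    and close: "A $$ (b + l - 1, b) = Fin w"
  shows "w \<in> cycle_means A"
proof -
  define c where "c = b + l - 1"
  define p where "p = map (\<lambda>i. (i, Suc i)) [b..<c] @ [(c, b)]"
  \<comment> \<open>Suffixes of the cycle, all ending at \<open>b\<close>, allow an induction on the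
    start \<open>u\<close>.\<close>
  have cas: "pre_digraph.cas (mat_digraph A) u (map (\<lambda>i. (i, Suc i)) [u..<c] @ [(c, b)]) b"
    if "u \<le> c" for u
    using that
    by (induction u rule: inc_induct) (auto simp: pre_digraph.cas.simps upt_conv_Cons)
  have const: "A $$ e = Fin w" if "e \<in> set p" for e
    using that step close b by (auto simp: p_def c_def)
  have "pre_digraph.cycle (mat_digraph A) p"
    unfolding cycle_mat_digraph_iff
  proof (intro exI conjI)
    show "pre_digraph.cas (mat_digraph A) b p b" using cas[of b] b by (simp add: p_def c_def)
    show "b < dim_row A" "p \<noteq> []" using A b by (auto simp: p_def)
    have "map snd p = map Suc [b..<c] @ [b]" by (simp add: p_def)
    then show "distinct (map snd p)" by (auto simp: distinct_map)
    show "set p \<subseteq> arcs (mat_digraph A)"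
    proof
      fix e assume e: "e \<in> set p"
      then have "fst e < n" "snd e < n" using b by (auto simp: p_def c_def)
      then show "e \<in> arcs (mat_digraph A)" using const[OF e] A by (cases e) auto
    qed
  qed
  moreover have "walk_weight A p / real (length p) = w"
    using walk_weight_const[of p A w] const by (simp add: p_def)
  ultimately show ?thesis unfolding cycle_means_def by force
qed

lemma interval_cycle_pow:
  assumes A: "A \<in> carrier_mat n n" and b: "l \<ge> 1" "b + l \<le> n"
    and step: "\<And>i. b \<le> i \<Longrightarrow> Suc i < b + l \<Longrightarrow> A $$ (i, Suc i) = Fin w"
    and close: "A $$ (b + l - 1, b) = Fin w"
  shows "Fin (real l * w) \<le> (A ^\<^sub>m l) $$ (b, b)"
proof -
  have append: "Fin (real k * w + w) \<le> (A ^\<^sub>m Suc k) $$ (b, j)"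
    if "Fin (real k * w) \<le> (A ^\<^sub>m k) $$ (b, i)" "A $$ (i, j) = Fin w" "i < n" "j < n" for i j k
  proof -
    have "Fin (real k * w) * Fin w \<le> (A ^\<^sub>m k) $$ (b, i) * (A ^\<^sub>m 1) $$ (i, j)"
      using that A by (intro maxplus_mult_mono) auto
    also have "\<dots> \<le> (A ^\<^sub>m (k + 1)) $$ (b, j)"
      using pow_entry_supermult[OF A, of b i j k 1] b that by simp
    finally show ?thesis by simp
  qed
  have "Fin (real k * w) \<le> (A ^\<^sub>m k) $$ (b, b + k)" if "k < l" for k
    using that
  proof (induction k)
    case 0
    then show ?case using A b by (simp add: one_maxplus_def)
  next
    case (Suc k)
    then show ?case using append[of k "b + k" "b + Suc k"] step[of "b + k"] b
      by (simp add: algebra_simps)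
  qed
  from append[OF this[of "l - 1"], of b] close b
  show ?thesis by (cases l) (simp_all add: algebra_simps)
qed


section \<open>The dumbbell matrix\<close>

text \<open>
  Nodes \<open>0, \<dots>, l - 1\<close> form a cycle with weights \<open>- D\<close>, nodes \<open>l, \<dots>, 2 l - 1\<close> a cycle
  with weights \<open>0\<close>.  They are joined by the edge from \<open>0\<close> to \<open>2 l - 1\<close> and the path
  from \<open>2 l - 1\<close> through \<open>2 l, \<dots>, n - 1\<close> back to \<open>0\<close>, with weights \<open>- M\<close>.
\<close>

definition dumbbell_mat :: "nat \<Rightarrow> nat \<Rightarrow> real \<Rightarrow> real \<Rightarrow> maxplus mat" where
  "dumbbell_mat l n D M = mat n n (\<lambda>(i, j).
     if i < l \<and> j = (if i = l - 1 then 0 else Suc i) then Fin (- D)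
     else if l \<le> i \<and> i < 2 * l \<and> j = (if i = 2 * l - 1 then l else Suc i) then Fin 0
     else if i = 0 \<and> j = 2 * l - 1 \<or> 2 * l - 1 \<le> i \<and> j = (if i = n - 1 then 0 else Suc i)
       then Fin (- M)
     else NegInf)"

locale dumbbell =
  fixes l n :: nat and D M :: real
  assumes l: "l \<ge> 1" "2 * l \<le> n" and D: "0 < D" "D \<le> M"
begin

abbreviation "A \<equiv> dumbbell_mat l n D M"

lemma A_carrier: "A \<in> carrier_mat n n" and A_dim [simp]: "dim_row A = n" "dim_col A = n"
  by (auto simp: dumbbell_mat_def)

lemma edges:
  "Suc i < l \<Longrightarrow> A $$ (i, Suc i) = Fin (- D)"
  "A $$ (l - 1, 0) = Fin (- D)"
  "l \<le> i \<Longrightarrow> Suc i < 2 * l \<Longrightarrow> A $$ (i, Suc i) = Fin 0"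
  "A $$ (2 * l - 1, l) = Fin 0"
  "A $$ (0, 2 * l - 1) = Fin (- M)"
  "2 * l - 1 \<le> i \<Longrightarrow> Suc i < n \<Longrightarrow> A $$ (i, Suc i) = Fin (- M)"
  "A $$ (n - 1, 0) = Fin (- M)"
  using l by (auto simp: dumbbell_mat_def)

lemma edge_cases:
  assumes "i < n" "j < n" "A $$ (i, j) = Fin w"
  obtains
    (slow) "i < l" "j = (if i = l - 1 then 0 else Suc i)" "w = - D"
  | (critical) "l \<le> i" "i < 2 * l" "j = (if i = 2 * l - 1 then l else Suc i)" "w = 0"
  | (enter) "i = 0" "j = 2 * l - 1" "w = - M"
  | (leave) "2 * l - 1 \<le> i" "j = (if i = n - 1 then 0 else Suc i)" "w = - M"
proof -
  have split: "P \<and> w = a \<or> Q \<and> w = b \<or> R \<and> w = c \<or> S \<and> w = c"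
    if "(if P then Fin a else if Q then Fin b else if R \<or> S then Fin c else NegInf) = Fin w"
    for P Q R S a b c
    using that by (auto split: if_splits)
  note assms(3)[unfolded dumbbell_mat_def index_mat(1)[OF assms(1,2)] prod.case, THEN split]
  then show thesis using that by blast
qed

lemma spread: "mat_spread A = M"
proof -
  have "finite_entries A = {0, - D, - M}"
  proof
    show "finite_entries A \<subseteq> {0, - D, - M}"
    proof
      fix w assume "w \<in> finite_entries A"
      then obtain i j where "i < n" "j < n" "A $$ (i, j) = Fin w"
        by (auto simp: finite_entries_def dest!: elements_matD)
      then show "w \<in> {0, - D, - M}" by (cases rule: edge_cases) auto
    qed
    have "w \<in> finite_entries A" if "i < n" "j < n" "A $$ (i, j) = Fin w" for i j w
      unfolding finite_entries_def using elements_matI[OF A_carrier that(1,2)] that(3) by auto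
    from this[OF _ _ edges(2)] this[OF _ _ edges(4)] this[OF _ _ edges(5)]
    show "{0, - D, - M} \<subseteq> finite_entries A" using l by auto
  qed
  then show ?thesis using D by (simp add: mat_spread_def)
qed

text \<open>Node \<open>0\<close> is a hub that reaches, and is reached from, every node. Both
  cycles and the path run along consecutive indices, so \<open>chain\<close> serves all
  three.\<close>

lemma irreducible: "irreducible_mat A"
proof -
  interpret wf_digraph "mat_digraph A" by (rule wf_mat_digraph[OF A_carrier])
  have adj: "i \<rightarrow>\<^bsub>mat_digraph A\<^esub> j" if "i < n" "j < n" "A $$ (i, j) = Fin w" for i j w
  proof -
    have "(i, j) \<in> arcs (mat_digraph A)" using that by simp
    then show ?thesis using in_arcs_imp_in_arcs_ends[of "(i, j)"] by simp
  qed
  have chain: "i \<rightarrow>\<^sup>*\<^bsub>mat_digraph A\<^esub> j"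
    if "i \<le> j" "j < n" "\<And>h. i \<le> h \<Longrightarrow> h < j \<Longrightarrow> \<exists>w. A $$ (h, Suc h) = Fin w" for i j
    using that
  proof (induction j rule: dec_induct)
    case (step j)
    then obtain w where "A $$ (j, Suc j) = Fin w" by auto
    then have "j \<rightarrow>\<^bsub>mat_digraph A\<^esub> Suc j" using adj step by auto
    moreover have "i \<rightarrow>\<^sup>*\<^bsub>mat_digraph A\<^esub> j" using step by auto
    ultimately show ?case by (rule reachable_adj_trans[rotated])
  qed auto
  have enter: "0 \<rightarrow>\<^bsub>mat_digraph A\<^esub> (2 * l - 1)" and leave: "(n - 1) \<rightarrow>\<^bsub>mat_digraph A\<^esub> 0"
    and slow: "(l - 1) \<rightarrow>\<^bsub>mat_digraph A\<^esub> 0" and critical: "(2 * l - 1) \<rightarrow>\<^bsub>mat_digraph A\<^esub> l"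
    using adj[OF _ _ edges(5)] adj[OF _ _ edges(7)] adj[OF _ _ edges(2)] adj[OF _ _ edges(4)] l
    by auto
  have out: "(2 * l - 1) \<rightarrow>\<^sup>*\<^bsub>mat_digraph A\<^esub> (n - 1)"
    using l edges(6) by (intro chain) auto
  have "0 \<rightarrow>\<^sup>*\<^bsub>mat_digraph A\<^esub> i \<and> i \<rightarrow>\<^sup>*\<^bsub>mat_digraph A\<^esub> 0" if "i < n" for i
  proof -
    consider "i < l" | "l \<le> i" "i < 2 * l" | "2 * l \<le> i" by linarith
    then show ?thesis
    proof cases
      case 1
      have "0 \<rightarrow>\<^sup>*\<^bsub>mat_digraph A\<^esub> i" using 1 that edges(1) by (intro chain) auto
      moreover have "i \<rightarrow>\<^sup>*\<^bsub>mat_digraph A\<^esub> (l - 1)"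
        using 1 that l edges(1) by (intro chain) auto
      ultimately show ?thesis using slow by (meson reachable_adj_trans)
    next
      case 2
      have "l \<rightarrow>\<^sup>*\<^bsub>mat_digraph A\<^esub> i" using 2 that edges(3) by (intro chain) auto
      moreover have "i \<rightarrow>\<^sup>*\<^bsub>mat_digraph A\<^esub> (2 * l - 1)"
        using 2 that l edges(3) by (intro chain) auto
      ultimately show ?thesis
        using enter critical out leave
        by (meson reachable_adj_trans adj_reachable_trans reachable_trans)
    next
      case 3
      have "(2 * l - 1) \<rightarrow>\<^sup>*\<^bsub>mat_digraph A\<^esub> i" using 3 that edges(6) by (intro chain) auto
      moreover have "i \<rightarrow>\<^sup>*\<^bsub>mat_digraph A\<^esub> (n - 1)"
        using 3 that l edges(6) by (intro chain) auto
      ultimately show ?thesis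
        using enter leave by (meson reachable_adj_trans adj_reachable_trans reachable_trans)
    qed
  qed
  then have "u \<rightarrow>\<^sup>*\<^bsub>mat_digraph A\<^esub> v" if "u < n" "v < n" for u v
    using that by (meson reachable_trans)
  then show ?thesis
    unfolding irreducible_mat_def strongly_connected_def using l by auto
qed

section \<open>Cycle means of the dumbbell\<close>

text \<open>Without the edge from \<open>0\<close> to \<open>2 l - 1\<close> the critical cycle can
  be left but not entered. A walk starting outside therefore stays outside, and a walk ending inside
  was always inside; for a closed walk one of the two applies.\<close>

lemma walk_without_enter:
  assumes "pre_digraph.cas (mat_digraph A) u p v" "set p \<subseteq> arcs (mat_digraph A)"
    "(0, 2 * l - 1) \<notin> set p"
  shows "(u \<notin> {l..<2 * l} \<longrightarrow> v \<notin> {l..<2 * l} \<and> (\<forall>e \<in> set p. the_fin (A $$ e) \<le> - D)) \<and>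
    (v \<in> {l..<2 * l} \<longrightarrow> (\<forall>e \<in> set p. A $$ e = Fin 0))"
  using assms
proof (induction p arbitrary: u)
  case Nil
  then show ?case by (auto simp: pre_digraph.cas.simps)
next
  case (Cons e p)
  obtain x where e: "e = (u, x)" and p: "pre_digraph.cas (mat_digraph A) x p v"
    using Cons.prems by (cases e) (auto simp: pre_digraph.cas.simps)
  have IH: "(x \<notin> {l..<2 * l} \<longrightarrow> v \<notin> {l..<2 * l} \<and> (\<forall>e \<in> set p. the_fin (A $$ e) \<le> - D)) \<and>
    (v \<in> {l..<2 * l} \<longrightarrow> (\<forall>e \<in> set p. A $$ e = Fin 0))"
    using Cons.IH[OF p] Cons.prems by auto
  have "u < n" "x < n" "A $$ (u, x) \<noteq> NegInf" using Cons.prems e by auto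
  then obtain w where w: "A $$ (u, x) = Fin w" by (cases "A $$ (u, x)") auto
  from \<open>u < n\<close> \<open>x < n\<close> w show ?case
  proof (cases rule: edge_cases)
    case slow
    then show ?thesis using IH w l by (auto simp: e split: if_splits)
  next
    case critical
    then show ?thesis using IH w l by (auto simp: e split: if_splits)
  next
    case enter
    then show ?thesis using Cons.prems e by auto
  next
    case leave
    then have "x \<notin> {l..<2 * l}" using l by (auto split: if_splits)
    then show ?thesis using IH w leave D by (auto simp: e)
  qed
qed

text \<open>
  An elementary cycle through the edge into \<open>2 l - 1\<close> cannot reach that node along the
  critical cycle as well, so going backwards it contains no edge of the critical cycle.
\<close>

lemma cycle_with_enter:
  assumes cas: "pre_digraph.cas (mat_digraph A) u p u" and p: "p \<noteq> []"
    "set p \<subseteq> arcs (mat_digraph A)" "distinct (map snd p)" "(0, 2 * l - 1) \<in> set p"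
    and e: "e \<in> set p"
  shows "the_fin (A $$ e) \<le> - D"
proof -
  have heads: "fst ` set p = snd ` set p" using closed_cas_tails_eq_heads cas p by blast
  have inj: "inj_on snd (set p)" using p by (simp add: distinct_map)
  \<comment> \<open>A visited inner node \<open>i\<close> of the critical cycle can only be left to
    \<open>i + 1\<close>, so the cycle would run up to \<open>2 l - 1\<close> and enter it by a
    second arc. The induction is on the distance to \<open>2 l - 1\<close>.\<close>
  have off: "i \<notin> fst ` set p" if "l \<le> i" "i < 2 * l - 1" for i
    using that
  proof (induction "2 * l - 1 - i" arbitrary: i)
    case (Suc d)
    show ?case
    proof
      assume "i \<in> fst ` set p"
      then obtain x where x: "(i, x) \<in> set p" by force
      then have "i < n" "x < n" "A $$ (i, x) \<noteq> NegInf" using p by auto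
      then obtain w where w: "A $$ (i, x) = Fin w" by (cases "A $$ (i, x)") auto
      from \<open>i < n\<close> \<open>x < n\<close> w have "x = Suc i"
        by (cases rule: edge_cases) (use Suc.prems in auto)
      show False
      proof (cases "Suc i = 2 * l - 1")
        case True
        then have "(i, x) = (0, 2 * l - 1)"
          using x p \<open>x = Suc i\<close> by (intro inj_onD[OF inj]) auto
        then show False using Suc.prems l by simp
      next
        case False
        then have "Suc i \<notin> fst ` set p" using Suc by auto
        then show False unfolding heads using x \<open>x = Suc i\<close> by force
      qed
    qed
  qed auto
  obtain i j where ij: "e = (i, j)" by force
  then have "i < n" "j < n" "A $$ (i, j) \<noteq> NegInf" using p e by auto
  then obtain w where w: "A $$ (i, j) = Fin w" by (cases "A $$ (i, j)") auto
  from \<open>i < n\<close> \<open>j < n\<close> w show ?thesis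
  proof (cases rule: edge_cases)
    case critical
    have "i \<in> fst ` set p" "j \<in> fst ` set p" unfolding heads using e ij heads by force+
    then have "i = 2 * l - 1" using off[of i] critical by fastforce
    then have "j = l" using critical by simp
    \<comment> \<open>Only the arc from \<open>2 l - 1\<close> to \<open>l\<close> remains. It makes
      \<open>l\<close> a visited node, so \<open>l = 1\<close>, and then this loop shares its head
      with the entering arc.\<close>
    then have "l = 2 * l - 1" using off[of l] \<open>j \<in> _\<close> l by fastforce
    then have "(i, j) = (0, 2 * l - 1)"
      using e ij p \<open>j = l\<close> by (intro inj_onD[OF inj]) auto
    then show ?thesis using critical l by simp
  qed (use ij w D in auto)
qed

text \<open>The weights along a cycle are either all \<open>0\<close> or all at most
  \<open>- D\<close>, and the mean inherits this.\<close>

lemma cycle_means_dichotomy: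
  assumes "x \<in> cycle_means A"
  shows "x = 0 \<or> x \<le> - D"
proof -
  obtain p where x: "x = walk_weight A p / real (length p)" "pre_digraph.cycle (mat_digraph A) p"
    using assms by (auto simp: cycle_means_def)
  then obtain u where p: "set p \<subseteq> arcs (mat_digraph A)" "pre_digraph.cas (mat_digraph A) u p u"
    "distinct (map snd p)" "p \<noteq> []"
    by (auto simp: cycle_mat_digraph_iff)
  consider "\<forall>e \<in> set p. A $$ e = Fin 0" | "\<forall>e \<in> set p. the_fin (A $$ e) \<le> - D"
    using walk_without_enter[of u p u] cycle_with_enter[of u p] p by blast
  then show ?thesis
  proof cases
    case 1
    then show ?thesis using x walk_weight_const[of p A 0] by simp
  next
    case 2
    then have "walk_weight A p \<le> real (length p) * - D" by (intro walk_weight_le) auto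
    then show ?thesis using x p by (simp add: pos_divide_le_eq mult.commute)
  qed
qed

lemma zero_cycle_mean: "0 \<in> cycle_means A"
  and slow_cycle_mean: "- D \<in> cycle_means A"
proof -
  show "0 \<in> cycle_means A"
    by (rule interval_cycle_mean[OF A_carrier, of l l]) (use l edges in \<open>auto simp: mult_2\<close>)
  show "- D \<in> cycle_means A"
    by (rule interval_cycle_mean[OF A_carrier, of l 0]) (use l edges in auto)
qed

lemma max_cycle_mean: "max_cycle_mean A = 0"
  unfolding max_cycle_mean_def
  using finite_cycle_means zero_cycle_mean cycle_means_dichotomy D
  by (intro Max_eqI) force+

lemma slow_noncritical: "- D \<in> noncritical_cycle_means A"
  unfolding noncritical_cycle_means_def max_cycle_mean using slow_cycle_mean D by simp

lemma second_cycle_mean: "second_cycle_mean A = - D"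
  unfolding second_cycle_mean_def
proof (rule Max_eqI)
  show "finite (noncritical_cycle_means A)"
    unfolding noncritical_cycle_means_def using finite_cycle_means by simp
  show "x \<le> - D" if "x \<in> noncritical_cycle_means A" for x
    using that cycle_means_dichotomy[of x] unfolding noncritical_cycle_means_def max_cycle_mean
    by auto
qed (rule slow_noncritical)

section \<open>Return weights and eventual periodicity of the dumbbell\<close>

lemma critical_return: "1 \<le> (A ^\<^sub>m l) $$ (l, l)"
proof -
  have "Fin (real l * 0) \<le> (A ^\<^sub>m l) $$ (l, l)"
    by (rule interval_cycle_pow[OF A_carrier]) (use l edges in \<open>auto simp: mult_2\<close>)
  then show ?thesis by (simp add: one_maxplus_def)
qed

lemma slow_return:
  assumes "l dvd k"
  shows "Fin (- D * real k) \<le> (A ^\<^sub>m k) $$ (0, 0)"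
proof -
  obtain t where k: "k = t * l" using assms by (metis dvd_def mult.commute)
  have mono: "x ^ t \<le> y ^ t" if "x \<le> y" for x y :: maxplus
    using that by (induction t) (auto intro: maxplus_mult_mono)
  have pow: "Fin x ^ t = Fin (real t * x)" for x
    by (induction t) (auto simp: one_maxplus_def algebra_simps)
  have "Fin (real l * - D) \<le> (A ^\<^sub>m l) $$ (0, 0)"
    by (rule interval_cycle_pow[OF A_carrier]) (use l edges in auto)
  then have "Fin (real l * - D) ^ t \<le> (A ^\<^sub>m l) $$ (0, 0) ^ t" by (rule mono)
  also have "\<dots> \<le> (A ^\<^sub>m k) $$ (0, 0)"
    unfolding k by (rule pow_diag_power_le[OF A_carrier]) (use l in auto)
  finally show ?thesis by (simp add: pow k algebra_simps)
qed

text \<open>Finite entries of the powers have the form \<open>- (a M + b D)\<close> with natural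
  numbers \<open>a\<close> and \<open>b\<close>. As \<open>M\<close> and \<open>D\<close> are
  positive, only finitely many such values exceed a given bound, which forces the powers to
  repeat.\<close>

lemma periodic:
  obtains p K where "p \<ge> 1" "periodic_from (\<lambda>k. A ^\<^sub>m k) p 0 K"
proof -
  define val where "val = (\<lambda>(a, b). Fin (- (real a * M + real b * D)))"
  define S where "S = insert NegInf (range val)"
  show thesis
  proof (rule powers_eventually_periodic[OF A_carrier irreducible _ critical_return l(1)])
    show "0 \<in> S" by (simp add: S_def zero_maxplus_def)
    have "val (0, 0) = 1" by (simp add: val_def one_maxplus_def)
    then show "1 \<in> S" unfolding S_def by (metis insertCI rangeI)
    have "val (a, b) * val (a', b') = val (a + a', b + b')" for a b a' b'
      by (simp add: val_def algebra_simps)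
    then have "val x * val y \<in> range val" for x y by (metis rangeI surj_pair)
    moreover have "NegInf * x = NegInf" "x * NegInf = NegInf" for x by (cases x; simp)+
    ultimately show "x * y \<in> S" if "x \<in> S" "y \<in> S" for x y
      using that unfolding S_def by auto
    have "val (0, 0) = Fin 0" "val (1, 0) = Fin (- M)" "val (0, 1) = Fin (- D)"
      by (simp_all add: val_def)
    then have "Fin 0 \<in> S" "Fin (- M) \<in> S" "Fin (- D) \<in> S"
      unfolding S_def by (metis insertCI rangeI)+
    moreover have "NegInf \<in> S" by (simp add: S_def)
    ultimately show "A $$ (i, j) \<in> S" if "i < n" "j < n" for i j
      using that by (auto simp: dumbbell_mat_def)
    show "finite {w \<in> S. Fin b \<le> w}" for b
    proof (rule finite_subset)
      let ?N = "\<lambda>x. {..nat \<lceil>- b / x\<rceil>}"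
      show "{w \<in> S. Fin b \<le> w} \<subseteq> val ` (?N M \<times> ?N D)"
      proof
        fix w assume "w \<in> {w \<in> S. Fin b \<le> w}"
        then obtain u v :: nat where w: "w = val (u, v)" "real u * M + real v * D \<le> - b"
          by (auto simp: S_def val_def)
        have "0 \<le> real u * M" "0 \<le> real v * D" using D by auto
        then have "real u * M \<le> - b" "real v * D \<le> - b" using w by linarith+
        then have "real u \<le> - b / M" "real v \<le> - b / D" using D by (auto simp: field_simps)
        then have "real u \<le> real (nat \<lceil>- b / M\<rceil>)" "real v \<le> real (nat \<lceil>- b / D\<rceil>)"
          using real_nat_ceiling_ge by (meson order.trans)+
        then have "u \<in> ?N M" "v \<in> ?N D" by (simp_all only: of_nat_le_iff atMost_iff)
        then show "w \<in> val ` (?N M \<times> ?N D)" using w by auto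
      qed
    qed auto
  qed (use l that in auto)
qed


section \<open>The transient\<close>

text \<open>
  Reading a walk from \<open>0\<close> to \<open>y\<close> as \<open>t\<close> completed round trips followed by a partial one,
  \<open>offset y\<close> is the length modulo \<open>l\<close> of the partial trip and \<open>joins y\<close> counts its edges
  of weight \<open>- M\<close>.
\<close>

definition offset :: "nat \<Rightarrow> nat" where
  "offset y = (if y < l then y else y + 2)"

definition joins :: "nat \<Rightarrow> nat" where
  "joins y = (if y < l then 0 else if y < 2 * l then 1 else y - 2 * l + 2)"

text \<open>By induction on the last edge of an optimal walk. Either the slow cycle was never left
  and the weight is exact, or the edge to \<open>2 l - 1\<close> was taken, and being back on the
  slow cycle requires a completed trip. In the second case the slow edges are estimated by
  \<open>0\<close>.\<close>

lemma walk_from_slow: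
  assumes "y < n" "(A ^\<^sub>m k) $$ (0, y) = Fin w"
  shows "(y < l \<and> int l dvd int k - int y \<and> w = - D * real k) \<or>
    (\<exists>t. int l dvd int k - int t * (int n + 2) - int (offset y) \<and>
      w \<le> - M * real (t * (n - 2 * l + 2) + joins y) \<and> (y < l \<longrightarrow> t \<ge> 1))"
  using assms
proof (induction k arbitrary: y w)
  case 0
  then have "y = 0 \<and> w = 0"
    using l A_carrier by (cases "y = 0") (auto simp: one_maxplus_def zero_maxplus_def)
  then show ?case using l by auto
next
  case (Suc k)
  obtain h where h: "h < n" "(A ^\<^sub>m Suc k) $$ (0, y) = (A ^\<^sub>m k) $$ (0, h) * A $$ (h, y)"
    using pow_entry_Suc_attained[OF A_carrier] Suc.prems l by (metis gr0I le_zero_eq less_nat_zero_code)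
  obtain w' v where w': "(A ^\<^sub>m k) $$ (0, h) = Fin w'" and v: "A $$ (h, y) = Fin v"
    and w: "w = w' + v"
    using h Suc.prems by (cases "(A ^\<^sub>m k) $$ (0, h)"; cases "A $$ (h, y)") auto
  \<comment> \<open>A step along either cycle keeps the length minus the offset, except that closing
    the cycle changes it by \<open>l\<close>.\<close>
  have shift: "int l dvd b" if "int l dvd a" "b = a \<or> b = a + int l \<or> b = a - int l" for a b
    using that by auto
  from Suc.IH[OF h(1) w'] show ?case
  proof
    assume IH: "h < l \<and> int l dvd int k - int h \<and> w' = - D * real k"
    from h(1) Suc.prems(1) v show ?thesis
    proof (cases rule: edge_cases)
      case slow
      have "int l dvd int (Suc k) - int y"
        using IH by (elim conjE, elim shift) (use slow in auto)
      moreover have "w = - D * real (Suc k)" using IH w slow by (simp add: algebra_simps)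
      moreover have "y < l" using slow by (auto split: if_splits)
      ultimately show ?thesis by simp
    next
      case enter
      \<comment> \<open>Node \<open>2 l - 1\<close> is reached one edge after \<open>0\<close>, and
        \<open>2 l + 1\<close> is \<open>1\<close> modulo \<open>l\<close>; this explains the
        \<open>+ 2\<close> in \<open>offset\<close>.\<close>
      have "offset y = 2 * l + 1" "joins y = 1" "\<not> y < l"
        using enter l by (auto simp: offset_def joins_def)
      moreover have "int l dvd int (Suc k) - (2 * int l + 1)"
      proof -
        have "int l dvd int k - 2 * int l" using IH enter by (auto intro: dvd_diff)
        then show ?thesis by simp
      qed
      moreover have "w \<le> - M" using IH w enter D by simp
      ultimately show ?thesis by (intro disjI2 exI[of _ 0]) simp
    qed (use IH l in auto)
  next
    assume "\<exists>t. int l dvd int k - int t * (int n + 2) - int (offset h) \<and>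
      w' \<le> - M * real (t * (n - 2 * l + 2) + joins h) \<and> (h < l \<longrightarrow> t \<ge> 1)"
    then obtain t where t: "int l dvd int k - int t * (int n + 2) - int (offset h)"
      "w' \<le> - M * real (t * (n - 2 * l + 2) + joins h)" "h < l \<longrightarrow> t \<ge> 1"
      by blast
    \<comment> \<open>Shared bookkeeping: \<open>t'\<close> is the new trip count, and the last edge
      either does not raise the tally of joining edges or raises it by at most one at weight
      \<open>- M\<close>.\<close>
    have concl: ?thesis
      if "int l dvd int (Suc k) - int t' * (int n + 2) - int (offset y)"
        "t' * (n - 2 * l + 2) + joins y \<le> t * (n - 2 * l + 2) + joins h \<and> v \<le> 0 \<or>
         t' * (n - 2 * l + 2) + joins y \<le> t * (n - 2 * l + 2) + joins h + 1 \<and> v = - M"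
        "y < l \<longrightarrow> t' \<ge> 1" for t'
    proof -
      let ?a = "t' * (n - 2 * l + 2) + joins y" and ?b = "t * (n - 2 * l + 2) + joins h"
      from that(2) have "w \<le> - M * real ?a"
      proof (elim disjE conjE)
        assume *: "?a \<le> ?b" "v \<le> 0"
        then have "M * real ?a \<le> M * real ?b"
          using D by (intro mult_left_mono) (simp_all only: of_nat_le_iff)
        then show ?thesis using t(2) w * by linarith
      next
        assume *: "?a \<le> ?b + 1" "v = - M"
        then have "real ?a \<le> real ?b + 1" by linarith
        then have "M * real ?a \<le> M * (real ?b + 1)" using D by (intro mult_left_mono) auto
        moreover have "M * (real ?b + 1) = M * real ?b + M" by (simp add: distrib_left)
        ultimately show ?thesis using t(2) w * by linarith
      qed
      then show ?thesis using that by blast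
    qed
    from h(1) Suc.prems(1) v show ?thesis
    proof (cases rule: edge_cases)
      case slow
      then have "y < l" by (auto split: if_splits)
      then show ?thesis
        using slow t D by (intro concl[of t] shift[OF t(1)]) (auto simp: offset_def joins_def)
    next
      case critical
      then show ?thesis
        using t l by (intro concl[of t] shift[OF t(1)]) (auto simp: offset_def joins_def)
    next
      case enter
      have "int l dvd int (Suc k) - int t * (int n + 2) - int (offset y)"
      proof -
        have "offset h = 0" "offset y = 2 * l + 1" using enter l by (auto simp: offset_def)
        then have "int (Suc k) - int t * (int n + 2) - int (offset y)
          = (int k - int t * (int n + 2) - int (offset h)) - 2 * int l" by simp
        then show ?thesis using t(1) by (metis dvd_diff dvd_triv_right)
      qed
      then show ?thesis
        using enter l by (intro concl[of t]) (auto simp: joins_def)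
    next
      case leave
      show ?thesis
      proof (cases "h = n - 1")
        case True
        \<comment> \<open>The trip closes one step after \<open>offset (n - 1) = n + 1\<close>, and
          \<open>n + 2\<close> is congruent modulo \<open>l\<close> to the true trip length
          \<open>n - 2 l + 2\<close>.\<close>
        have "int (Suc k) - int (Suc t) * (int n + 2) - int (offset y)
          = int k - int t * (int n + 2) - int (offset h)"
          using True leave l by (auto simp: offset_def algebra_simps)
        with t(1) have "int l dvd int (Suc k) - int (Suc t) * (int n + 2) - int (offset y)"
          by (simp only:)
        moreover have "joins h = n - 2 * l + 1" "joins y = 0" "v = - M"
          using True leave l by (auto simp: joins_def)
        ultimately show ?thesis by (intro concl[of "Suc t"]) simp_all
      next
        case False
        then show ?thesis
          using leave l t(1) by (intro concl[of t]) (auto simp: joins_def offset_def algebra_simps)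
      qed
    qed
  qed
qed

section \<open>Lower bound on the transient\<close>

text \<open>Modulo \<open>l\<close> a round trip has length \<open>r\<close>, so \<open>t\<close>
  trips in a walk of length \<open>k\<close> give \<open>l dvd t * r\<close>, whence
  \<open>t\<close> is at least \<open>l / 3\<close>. The factor \<open>3\<close> on \<open>w\<close>
  clears the denominator.\<close>

lemma slow_return_upper:
  assumes n: "n + 2 = 3 * l + r" "1 \<le> r" "r \<le> 3"
    and k: "l dvd k" "(A ^\<^sub>m k) $$ (0, 0) = Fin w"
  shows "w = - D * real k \<or> 3 * w \<le> - M * real l * real (n - 2 * l + 2)"
proof -
  consider "w = - D * real k" |
    t where "int l dvd int k - int t * (int n + 2)" "w \<le> - M * real (t * (n - 2 * l + 2))" "t \<ge> 1"
    using walk_from_slow[OF _ k(2)] l by (auto simp: offset_def joins_def)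
  then show ?thesis
  proof cases
    case (2 t)
    have "int l dvd int k - (int k - int t * (int n + 2))"
      by (rule dvd_diff[OF _ 2(1)]) (use k(1) in simp)
    then have "int l dvd int (t * (n + 2))" by (simp add: algebra_simps)
    then have "l dvd t * (3 * l + r)" using n(1) by (metis int_dvd_int_iff)
    then have "l dvd t * r" by (simp add: distrib_left dvd_add_right_iff)
    then have "l \<le> t * r" using 2(3) n by (intro dvd_imp_le) auto
    also have "\<dots> \<le> 3 * t" using n by simp
    finally have "real l \<le> 3 * real t" by linarith
    then have "M * real m * real l \<le> M * real m * (3 * real t)" for m
      using D by (intro mult_left_mono) auto
    from this[of "n - 2 * l + 2"] show ?thesis
      using 2(2) unfolding of_nat_mult by (simp only: mult_ac) linarith
  qed simp
qed

text \<open>For a multiple \<open>k\<close> of \<open>l\<close> beyond the transient, ratio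
  \<open>0\<close> gives equal entries at \<open>k\<close> and \<open>k + l * p\<close>. At the
  latter length the slow cycle alone weighs less than the bound \<open>- D k\<close> valid at
  \<open>k\<close>, so round trips must pay for the entry.\<close>

lemma transient_lower_bound:
  assumes n: "n + 2 = 3 * l + r" "1 \<le> r" "r \<le> 3"
  shows "M * real l * real (n - 2 * l + 2)
    \<le> 3 * D * (real (transient (\<lambda>k. A ^\<^sub>m k)) + real l)"
proof -
  define K where "K = transient (\<lambda>k. A ^\<^sub>m k)"
  obtain p K0 where p: "p \<ge> 1" and per: "periodic_from (\<lambda>k. A ^\<^sub>m k) p 0 K0" by (rule periodic)
  have "\<exists>p \<rho>. p \<ge> 1 \<and> periodic_from (\<lambda>k. A ^\<^sub>m k) p \<rho> K"
    unfolding K_def transient_def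
  proof (rule LeastI)
    show "\<exists>p \<rho>. p \<ge> 1 \<and> periodic_from (\<lambda>k. A ^\<^sub>m k) p \<rho> K0"
      by (intro exI conjI) (rule p per)+
  qed
  then obtain p' \<rho> where p': "p' \<ge> 1" "periodic_from (\<lambda>k. A ^\<^sub>m k) p' \<rho> K" by blast
  \<comment> \<open>The least threshold may come with another period and ratio; thresholds do not
    depend on these, so ratio \<open>0\<close> holds from \<open>K\<close> on.\<close>
  have perK: "periodic_from (\<lambda>k. A ^\<^sub>m k) p 0 K"
    by (rule periodic_from_threshold_unique[OF p'(2,1) per])
  define k where "k = l * (K div l + 1)"
  have "k = K - K mod l + l" by (simp add: k_def minus_mod_eq_mult_div)
  moreover have "K mod l < l" "K mod l \<le> K" using l by auto
  ultimately have k: "K \<le> k" "k \<le> K + l" by linarith+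
  have k_dvd: "l dvd k" by (simp add: k_def)
  have slow: "Fin (- D * real k) \<le> (A ^\<^sub>m k) $$ (0, 0)" by (rule slow_return[OF k_dvd])
  then obtain w where w: "(A ^\<^sub>m k) $$ (0, 0) = Fin w" "- D * real k \<le> w"
    by (cases "(A ^\<^sub>m k) $$ (0, 0)") auto
  have "A ^\<^sub>m (k + l * p) = Fin 0 \<cdot>\<^sub>m A ^\<^sub>m k"
    using periodic_from_multiple[OF perK k(1), of l] by simp
  then have "(A ^\<^sub>m (k + l * p)) $$ (0, 0) = Fin w"
    using w l by simp
  then have "w = - D * real (k + l * p) \<or> 3 * w \<le> - M * real l * real (n - 2 * l + 2)"
    using k_dvd by (intro slow_return_upper[OF n]) auto
  moreover have "w \<noteq> - D * real (k + l * p)"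
  proof -
    have "0 < D * real (l * p)" using D l p by simp
    then show ?thesis using w(2) by (simp add: algebra_simps)
  qed
  ultimately have "M * real l * real (n - 2 * l + 2) \<le> 3 * (D * real k)" using w(2) by simp
  also have "D * real k \<le> D * (real K + real l)" using k(2) D by (intro mult_left_mono) auto
  finally show ?thesis by (simp add: K_def)
qed

lemma transient_quadratic:
  assumes n: "n + 2 = 3 * l + r" "1 \<le> r" "r \<le> 3" and large: "n \<ge> 14"
  shows "real n ^ 2 * M / D \<le> 108 * real (transient (\<lambda>k. A ^\<^sub>m k))"
proof -
  define K where "K = real (transient (\<lambda>k. A ^\<^sub>m k))"
  define q where "q = M / D"
  have q: "q \<ge> 1" "M = q * D" using D by (auto simp: q_def)
  have "D * (q * real l * real (n - 2 * l + 2)) \<le> D * (3 * (K + real l))"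
    using transient_lower_bound[OF n] by (simp add: K_def q algebra_simps)
  then have main: "q * real l * real (n - 2 * l + 2) \<le> 3 * (K + real l)" using D by simp
  have "3 * real l \<le> real n + 2" using n by linarith
  moreover have "real (n - 2 * l + 2) = real n - 2 * real l + 2" using l by (simp add: of_nat_diff)
  ultimately have m: "3 * real (n - 2 * l + 2) \<ge> real n + 2" by argo
  have "3 * l + 1 \<ge> n" using n by linarith
  then have l': "3 * real l \<ge> real n - 1" by linarith
  \<comment> \<open>As \<open>q\<close> is at least \<open>1\<close>, the term
    \<open>3 * real l\<close> is absorbed on the left, lowering the second factor by
    \<open>3\<close>.\<close>
  have "real l \<le> q * real l" using q by (simp add: mult_le_cancel_right1)
  then have "q * real l * (real (n - 2 * l + 2) - 3) \<le> 3 * K" using main by (simp add: algebra_simps)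
  \<comment> \<open>Both factors are at least \<open>n / 6\<close>; for the second,
    \<open>(n + 2) / 3 - 3 \<ge> n / 6\<close> amounts to \<open>n \<ge> 14\<close>. The constant is
    \<open>108 = 3 * 36\<close>.\<close>
  moreover have "q * ((real n / 6) * (real n / 6)) \<le> q * (real l * (real (n - 2 * l + 2) - 3))"
    using l' m large q by (intro mult_left_mono mult_mono) auto
  ultimately have "q * (real n * real n) \<le> 108 * K" by (simp add: algebra_simps)
  then show ?thesis by (simp add: K_def q_def power2_eq_square algebra_simps)
qed

end

theorem theorem11:
  fixes D M :: "nat \<Rightarrow> real"
  assumes "\<And>n. D n > 0" and "\<And>n. M n > 0" and "\<And>n. D n \<le> M n"
  shows "\<exists>A :: nat \<Rightarrow> maxplus mat.
    (\<forall>n\<ge>2. A n \<in> carrier_mat n n \<and> irreducible_mat (A n) \<and>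
       noncritical_cycle_means (A n) \<noteq> {} \<and>
       max_cycle_mean (A n) - second_cycle_mean (A n) = D n \<and>
       mat_spread (A n) = M n) \<and>
    (\<lambda>n. real (transient (\<lambda>k. A n ^\<^sub>m k)))
      \<in> \<Omega>(\<lambda>n. real n ^ 2 * mat_spread (A n)
              / (max_cycle_mean (A n) - second_cycle_mean (A n)))"
proof -
  \<comment> \<open>This \<open>l\<close> meets the locale conditions from \<open>n = 2\<close> on
    and is close to \<open>n / 3\<close>, which makes both \<open>l\<close> and the trip length
    linear in \<open>n\<close>.\<close>
  define A where "A = (\<lambda>n. dumbbell_mat ((n + 1) div 3) n (D n) (M n))"
  have db: "dumbbell ((n + 1) div 3) n (D n) (M n)" if "n \<ge> 2" for n
    using that assms by unfold_locales auto
  have gap: "max_cycle_mean (A n) - second_cycle_mean (A n) = D n" if "n \<ge> 2" for n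
    using dumbbell.max_cycle_mean[OF db[OF that]] dumbbell.second_cycle_mean[OF db[OF that]]
    by (simp add: A_def)
  have spread: "mat_spread (A n) = M n" if "n \<ge> 2" for n
    using dumbbell.spread[OF db[OF that]] by (simp add: A_def)
  have bound: "real n ^ 2 * M n / D n \<le> 108 * real (transient (\<lambda>k. A n ^\<^sub>m k))" if "n \<ge> 14" for n
  proof -
    \<comment> \<open>Shifting the remainder by one keeps it from being \<open>0\<close>, where a
      single round trip would already have length divisible by \<open>l\<close>.\<close>
    have r: "n + 2 = 3 * ((n + 1) div 3) + ((n + 1) mod 3 + 1)" "1 \<le> (n + 1) mod 3 + 1"
      "(n + 1) mod 3 + 1 \<le> 3" by presburger+
    show ?thesis
      unfolding A_def using dumbbell.transient_quadratic[OF db r] that by auto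
  qed
  have "A n \<in> carrier_mat n n \<and> irreducible_mat (A n) \<and> noncritical_cycle_means (A n) \<noteq> {}"
    if "n \<ge> 2" for n
    using dumbbell.A_carrier[OF db[OF that]] dumbbell.irreducible[OF db[OF that]]
      dumbbell.slow_noncritical[OF db[OF that]] by (auto simp: A_def)
  moreover have "(\<lambda>n. real (transient (\<lambda>k. A n ^\<^sub>m k)))
      \<in> \<Omega>(\<lambda>n. real n ^ 2 * mat_spread (A n)
              / (max_cycle_mean (A n) - second_cycle_mean (A n)))"
  proof (rule landau_omega.bigI[of "1 / 108"])
    show "\<forall>\<^sub>F n in sequentially. norm (real (transient (\<lambda>k. A n ^\<^sub>m k))) \<ge> 1 / 108 *
      norm (real n ^ 2 * mat_spread (A n) / (max_cycle_mean (A n) - second_cycle_mean (A n)))"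
      using eventually_ge_at_top[of 14]
    proof eventually_elim
      case (elim n)
      have "0 \<le> real n ^ 2 * M n / D n" using assms[of n] by (simp add: less_imp_le)
      then show ?case using elim bound[of n] by (simp add: gap spread)
    qed
  qed simp
  ultimately show ?thesis using gap spread by blast
qed

end
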